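(* Let $r\in C^\infty(J)$ be an admissible function and $\lambda\in\mathbb{R}$. Put $$\alpha(t)=\frac{-1}{r(t)\sqrt{1-r'(t)^2}},\qquad \beta(t)=\frac{r''(t)r(t)+r'(t)^2-1}{r(t)(1-r'(t)^2)^{3/2}}.$$ The Lorentzian hypersurface $Q(r)$ of $\mathbb{L}^{n+2}$ has proportional principal curvatures with constant $\lambda$, i.e. it satisfies $\lambda\,\alpha(t)=\alpha(t)-\beta(t)$ for all $t\in J$, if and only if $$r(t)r''(t)=\lambda\big(1-r'(t)^2\big)\quad\text{for all } t\in J.$$
   Context: $\mathbb{L}^{n+2}$ is $\mathbb{R}^{n+2}$ with coordinates $(t,x)=(t,x_1,\dots,x_{n+1})$ and the Lorentzian metric $\langle\,,\rangle=-dt^2+dx_1^2+\dots+dx_{n+1}^2$. Let $J\subset\mathbb{R}$ be an open interval with $0\in J$. A function $r\in C^\infty(J)$ is called admissible if $r(t)>0$ and $|r'(t)|<1$ for all $t\in J$. For such $r$, $Q(r)=\{(t,x)\in J\times\mathbb{R}^{n+1}: x_1^2+\dots+x_{n+1}^2=r(t)^2\}$, a hypersurface of $\mathbb{L}^{n+2}$ whose induced metric is Lorentzian. With respect to the unit normal $N(t,x)=\frac{1}{r(t)\sqrt{1-r'(t)^2}}(r'(t)r(t),x)$, its Weingarten operator $A(V)=-\nabla^0_VN$ ($\nabla^0$ the Levi-Civita connection of $\mathbb{L}^{n+2}$) has principal curvature $\alpha(t)-\beta(t)$ in the axial direction $T(t,x)=\frac{1}{\sqrt{1-r'(t)^2}}\big(1,\frac{r'(t)}{r(t)}x\big)$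 and $\alpha(t)$ in every (rotational) direction tangent to $Q(r)$ and orthogonal to $T$. $Q(r)$ is said to have proportional principal curvatures when there exists $\lambda\in\mathbb{R}$ with $\lambda\,\alpha(t)=\alpha(t)-\beta(t)$ for all $t\in J$. *)

theory Defs
  imports "HOL-Analysis.Analysis"
begin

text \<open>Points and vectors of the \<open>(n + 2)\<close>-dimensional Lorentz--Minkowski space are pairs
  \<open>(t, x)\<close> of type \<^typ>\<open>real \<times> (real ^ 'n)\<close>, with \<open>CARD('n) = n + 1\<close>.\<close>

definition lorentz :: "real \<times> (real ^ 'n) \<Rightarrow> real \<times> (real ^ 'n) \<Rightarrow> real" where
  "lorentz V W = - (fst V * fst W) + snd V \<bullet> snd W"

text \<open>Functions on \<open>J\<close> are total functions of which only the values on the open set \<open>J\<close> matter;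
  so \<^const>\<open>deriv\<close> at a point of \<open>J\<close> is the derivative of the restriction to \<open>J\<close>.\<close>

definition smooth_on :: "real set \<Rightarrow> (real \<Rightarrow> real) \<Rightarrow> bool" where
  "smooth_on J r \<longleftrightarrow> (\<forall>k. \<forall>t\<in>J. (deriv ^^ k) r differentiable (at t))"

definition admissible :: "real set \<Rightarrow> (real \<Rightarrow> real) \<Rightarrow> bool" where
  "admissible J r \<longleftrightarrow> smooth_on J r \<and> (\<forall>t\<in>J. r t > 0 \<and> \<bar>deriv r t\<bar> < 1)"

definition Q :: "real set \<Rightarrow> (real \<Rightarrow> real) \<Rightarrow> (real \<times> (real ^ 'n)) set" where
  "Q J r = {(t, x). t \<in> J \<and> (\<Sum>i\<in>UNIV. (x $ i)\<^sup>2) = (r t)\<^sup>2}"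

text \<open>The kernel of the differential of \<open>(t, x) \<mapsto> (\<bar>x\<bar>\<^sup>2 - r(t)\<^sup>2) / 2\<close>.\<close>

definition tangent_space :: "(real \<Rightarrow> real) \<Rightarrow> real \<times> (real ^ 'n) \<Rightarrow> (real \<times> (real ^ 'n)) set" where
  "tangent_space r = (\<lambda>(t, x). {(s, v). x \<bullet> v = r t * deriv r t * s})"

definition unit_normal :: "(real \<Rightarrow> real) \<Rightarrow> real \<times> (real ^ 'n) \<Rightarrow> real \<times> (real ^ 'n)" where
  "unit_normal r = (\<lambda>(t, x). (1 / (r t * sqrt (1 - (deriv r t)\<^sup>2))) *\<^sub>R (deriv r t * r t, x))"

definition axial :: "(real \<Rightarrow> real) \<Rightarrow> real \<times> (real ^ 'n) \<Rightarrow> real \<times> (real ^ 'n)" where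
  "axial r = (\<lambda>(t, x). (1 / sqrt (1 - (deriv r t)\<^sup>2)) *\<^sub>R (1, (deriv r t / r t) *\<^sub>R x))"

text \<open>The Levi-Civita connection of the flat metric is the componentwise directional derivative.
  The formula for the normal makes sense on the open set \<open>J \<times> \<real>\<^sup>n\<^sup>+\<^sup>1\<close>, so the
  derivative is taken there; on tangent vectors of \<open>Q J r\<close> it does not depend on the extension.\<close>

definition weingarten ::
    "(real \<Rightarrow> real) \<Rightarrow> real \<times> (real ^ 'n) \<Rightarrow> real \<times> (real ^ 'n) \<Rightarrow> real \<times> (real ^ 'n)" where
  "weingarten r p V = - frechet_derivative (unit_normal r) (at p) V"

definition principal_curvature_in ::
    "(real \<Rightarrow> real) \<Rightarrow> real \<times> (real ^ 'n) \<Rightarrow> real \<times> (real ^ 'n) \<Rightarrow> real \<Rightarrow> bool" where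
  "principal_curvature_in r p V k \<longleftrightarrow>
     V \<in> tangent_space r p \<and> V \<noteq> 0 \<and> weingarten r p V = k *\<^sub>R V"

text \<open>\<open>Q J r\<close> has principal curvature \<open>a - b\<close> in the axial direction and \<open>a\<close> in every rotational
  direction.\<close>

definition principal_curvatures ::
    "'n::finite itself \<Rightarrow> real set \<Rightarrow> (real \<Rightarrow> real) \<Rightarrow> (real \<Rightarrow> real) \<Rightarrow> (real \<Rightarrow> real) \<Rightarrow> bool" where
  "principal_curvatures _ J r a b \<longleftrightarrow>
     (\<forall>(t, x) \<in> (Q J r :: (real \<times> (real ^ 'n)) set).
        principal_curvature_in r (t, x) (axial r (t, x)) (a t - b t) \<and>
        (\<forall>V \<in> tangent_space r (t, x). V \<noteq> 0 \<longrightarrow> lorentz V (axial r (t, x)) = 0 \<longrightarrow>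
           principal_curvature_in r (t, x) V (a t)))"

definition alpha :: "(real \<Rightarrow> real) \<Rightarrow> real \<Rightarrow> real" where
  "alpha r t = - 1 / (r t * sqrt (1 - (deriv r t)\<^sup>2))"

definition beta :: "(real \<Rightarrow> real) \<Rightarrow> real \<Rightarrow> real" where
  "beta r t = (deriv (deriv r) t * r t + (deriv r t)\<^sup>2 - 1) /
     (r t * (1 - (deriv r t)\<^sup>2) powr (3 / 2))"

text \<open>The first conjunct ties \<^const>\<open>alpha\<close> and \<^const>\<open>beta\<close> to the geometry of \<open>Q J r\<close>; it
  holds for every admissible \<open>r\<close>, by \<open>principal_curvatures_alpha_beta\<close> below.\<close>

definition proportional_principal_curvatures ::
    "'n::finite itself \<Rightarrow> real set \<Rightarrow> (real \<Rightarrow> real) \<Rightarrow> real \<Rightarrow> bool" where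
  "proportional_principal_curvatures N J r lam \<longleftrightarrow>
     principal_curvatures N J r (alpha r) (beta r) \<and>
     (\<forall>t\<in>J. lam * alpha r t = alpha r t - beta r t)"

lemma unit_normal_is_unit_normal:
  fixes x :: "real ^ 'n"
  assumes "admissible J r" "(t, x) \<in> Q J r"
  shows "lorentz (unit_normal r (t, x)) (unit_normal r (t, x)) = 1"
    and "V \<in> tangent_space r (t, x) \<Longrightarrow> lorentz (unit_normal r (t, x)) V = 0"
proof -
  have r: "r t > 0" "\<bar>deriv r t\<bar> < 1" and xx: "x \<bullet> x = (r t)\<^sup>2"
    using assms by (auto simp: admissible_def Q_def inner_vec_def power2_eq_square)
  have d: "1 - (deriv r t)\<^sup>2 > 0"
    using r(2) by (simp add: abs_square_less_1)
  define c where "c = r t * sqrt (1 - (deriv r t)\<^sup>2)"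
  have c: "c\<^sup>2 = (r t)\<^sup>2 * (1 - (deriv r t)\<^sup>2)" "c > 0"
    using r d by (simp_all add: c_def power_mult_distrib)
  have "lorentz (unit_normal r (t, x)) (unit_normal r (t, x)) =
      (1 / c)\<^sup>2 * (x \<bullet> x - (deriv r t * r t)\<^sup>2)"
    unfolding unit_normal_def prod.case c_def[symmetric]
    by (simp add: lorentz_def power2_eq_square diff_divide_distrib)
  also have "\<dots> = (1 / c)\<^sup>2 * c\<^sup>2"
    unfolding xx c(1) by (simp add: power2_eq_square algebra_simps)
  also have "\<dots> = 1"
    using c(2) by (simp add: power_divide)
  finally show "lorentz (unit_normal r (t, x)) (unit_normal r (t, x)) = 1" .
  show "lorentz (unit_normal r (t, x)) V = 0" if "V \<in> tangent_space r (t, x)"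
    using that by (auto simp: lorentz_def unit_normal_def tangent_space_def field_simps)
qed

lemma principal_curvatures_alpha_beta:
  assumes "admissible J r"
  shows "principal_curvatures TYPE('n::finite) J r (alpha r) (beta r)"
  unfolding principal_curvatures_def
proof (intro ballI, clarify)
  fix t and x :: "real ^ 'n"
  assume "(t, x) \<in> Q J r"
  then have t: "t \<in> J" and xx: "x \<bullet> x = (r t)\<^sup>2"
    by (auto simp: Q_def inner_vec_def power2_eq_square)
  define p where "p = deriv r t"
  define q where "q = deriv (deriv r) t"
  define w where "w = sqrt (1 - p\<^sup>2)"
  have r: "r t > 0" "\<bar>p\<bar> < 1"
    using assms t by (auto simp: admissible_def p_def)
  have d: "1 - p\<^sup>2 > 0"
    using r(2) by (simp add: abs_square_less_1)
  then have w: "w > 0" "w\<^sup>2 = 1 - p\<^sup>2"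
    by (auto simp: w_def)
  have "(deriv ^^ 0) r differentiable (at t)" "(deriv ^^ 1) r differentiable (at t)"
    using assms t unfolding admissible_def smooth_on_def by blast+
  then have D1: "(r has_field_derivative p) (at t)"
    and D2: "(deriv r has_field_derivative q) (at t)"
    by (auto simp: p_def q_def DERIV_deriv_iff_real_differentiable)
  have Dw: "((\<lambda>t. sqrt (1 - (deriv r t)\<^sup>2)) has_field_derivative (- p * q / w)) (at t)"
    using d by (auto intro!: derivative_eq_intros D2 simp: w_def p_def[symmetric] field_simps)
  define f where "f = (\<lambda>t. 1 / (r t * sqrt (1 - (deriv r t)\<^sup>2)))"
  define g where "g = (\<lambda>t. deriv r t / sqrt (1 - (deriv r t)\<^sup>2))"
  define f' where "f' = - (p * w + r t * (- p * q / w)) / (r t * w)\<^sup>2"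
  define g' where "g' = (q * w - p * (- p * q / w)) / w\<^sup>2"
  have "((\<lambda>t. r t * sqrt (1 - (deriv r t)\<^sup>2)) has_field_derivative
      (p * w + r t * (- p * q / w))) (at t)"
    using DERIV_mult[OF D1 Dw] unfolding p_def[symmetric] w_def[symmetric]
    by (simp add: mult.commute)
  from DERIV_divide[OF DERIV_const[of 1] this] have Df: "(f has_field_derivative f') (at t)"
    unfolding f_def f'_def p_def[symmetric] w_def[symmetric] using w(1) r(1)
    by (simp add: power2_eq_square)
  have Dg: "(g has_field_derivative g') (at t)"
    unfolding g_def g'_def
    using DERIV_divide[OF D2 Dw] w(1) unfolding p_def[symmetric] w_def[symmetric]
    by (simp add: power2_eq_square)
  have fst': "((\<lambda>y. h (fst y)) has_derivative (\<lambda>V. h' * fst V)) (at (t, x))"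
    if "(h has_field_derivative h') (at t)" for h h'
  proof -
    have "(h has_derivative (\<lambda>s. h' * s)) (at (fst (t, x)))"
      using that by (simp add: has_field_derivative_def)
    from has_derivative_compose[OF has_derivative_fst[OF has_derivative_ident] this]
    show ?thesis by simp
  qed
  have DN0: "((\<lambda>y. (g (fst y), f (fst y) *\<^sub>R snd y)) has_derivative
      (\<lambda>V. (g' * fst V, f t *\<^sub>R snd V + (f' * fst V) *\<^sub>R x))) (at (t, x))"
    by (auto intro!: derivative_eq_intros fst'[OF Df] fst'[OF Dg])
  have "(r \<longlongrightarrow> r t) (nhds t)"
    using DERIV_isCont[OF D1] by (simp add: isCont_def tendsto_nhds_iff)
  then have "\<forall>\<^sub>F s in nhds t. r s \<noteq> 0"
    using r(1) by (intro tendsto_imp_eventually_ne) auto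
  then obtain S where S: "open S" "t \<in> S" "\<And>s. s \<in> S \<Longrightarrow> r s \<noteq> 0"
    by (auto simp: eventually_nhds)
  have DN: "((unit_normal r) has_derivative
      (\<lambda>V. (g' * fst V, f t *\<^sub>R snd V + (f' * fst V) *\<^sub>R x))) (at (t, x))"
  proof (rule has_derivative_transform_within_open[OF DN0, of "S \<times> UNIV"])
    show "open (S \<times> (UNIV :: (real ^ 'n) set))"
      using S by (auto intro: open_Times)
    show "(t, x) \<in> S \<times> UNIV"
      using S by auto
    show "(g (fst y), f (fst y) *\<^sub>R snd y) = unit_normal r y" if "y \<in> S \<times> UNIV" for y
      using that S(3) by (auto simp: unit_normal_def f_def g_def)
  qed
  have A: "weingarten r (t, x) V = - (g' * fst V, f t *\<^sub>R snd V + (f' * fst V) *\<^sub>R x)" for V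
    unfolding weingarten_def frechet_derivative_at[OF DN, symmetric] ..
  have ft: "f t = - alpha r t"
    by (simp add: f_def alpha_def)
  have powr: "(1 - p\<^sup>2) powr (3 / 2) = w ^ 3"
  proof -
    have "(1 - p\<^sup>2) powr (3 / 2) = ((1 - p\<^sup>2) powr (1 / 2)) powr 3"
      by (simp add: powr_powr)
    also have "\<dots> = w ^ 3"
      using w d by (simp add: powr_half_sqrt w_def)
    finally show ?thesis .
  qed
  have ab: "alpha r t - beta r t = - q / w ^ 3"
  proof -
    have "alpha r t = - (w\<^sup>2) / (r t * w ^ 3)"
      unfolding alpha_def p_def[symmetric] w_def[symmetric]
      using w(1) r(1) by (simp add: power2_eq_square power3_eq_cube)
    moreover have "beta r t = (q * r t - w\<^sup>2) / (r t * w ^ 3)"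
      by (simp add: beta_def p_def[symmetric] q_def[symmetric] powr w(2))
    ultimately have "alpha r t - beta r t = - (q * r t) / (r t * w ^ 3)"
      by (simp add: diff_divide_distrib)
    then show ?thesis using r by simp
  qed
  have g': "g' = q / w ^ 3"
  proof -
    have "g' = q * (w\<^sup>2 + p\<^sup>2) / w ^ 3"
      using w(1) by (simp add: g'_def field_simps power2_eq_square power3_eq_cube)
    then show ?thesis using w(2) by simp
  qed
  have f': "f t * (p / r t) + f' = p * q / (r t * w ^ 3)"
    using w(1) r(1) unfolding f'_def f_def p_def[symmetric] w_def[symmetric]
    by (simp add: field_simps power2_eq_square power3_eq_cube)
  have T: "axial r (t, x) = (1 / w, (p / (r t * w)) *\<^sub>R x)"
    by (simp add: axial_def p_def[symmetric] w_def[symmetric])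
  have "weingarten r (t, x) (axial r (t, x)) = (alpha r t - beta r t) *\<^sub>R axial r (t, x)"
  proof -
    have "f t * (p / (r t * w)) + f' * (1 / w) = (f t * (p / r t) + f') / w"
      by (simp add: add_divide_distrib)
    also have "\<dots> = q / w ^ 3 * (p / (r t * w))"
      unfolding f' by (simp add: ac_simps)
    finally have "f t *\<^sub>R ((p / (r t * w)) *\<^sub>R x) + (f' * (1 / w)) *\<^sub>R x =
        (q / w ^ 3 * (p / (r t * w))) *\<^sub>R x"
      by (metis scaleR_add_left scaleR_scaleR)
    then show ?thesis
      unfolding A T ab g' by simp
  qed
  moreover have "axial r (t, x) \<in> tangent_space r (t, x)"
    using r w xx unfolding T tangent_space_def
    by (simp add: p_def[symmetric] power2_eq_square)
  moreover have "axial r (t, x) \<noteq> 0"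
    using w unfolding T by (simp add: zero_prod_def)
  ultimately show "principal_curvature_in r (t, x) (axial r (t, x)) (alpha r t - beta r t) \<and>
        (\<forall>V \<in> tangent_space r (t, x). V \<noteq> 0 \<longrightarrow> lorentz V (axial r (t, x)) = 0 \<longrightarrow>
           principal_curvature_in r (t, x) V (alpha r t))"
  proof (intro conjI ballI impI)
    fix V :: "real \<times> (real ^ 'n)"
    assume V: "V \<in> tangent_space r (t, x)" "V \<noteq> 0" "lorentz V (axial r (t, x)) = 0"
    have tan: "snd V \<bullet> x = r t * p * fst V"
      using V(1) by (auto simp: tangent_space_def p_def inner_commute)
    have "lorentz V (axial r (t, x)) = - (fst V * (1 - p\<^sup>2) / w)"
      using r w(1) by (simp add: lorentz_def T tan field_simps power2_eq_square)
    then have "fst V = 0"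
      using V(3) w d by auto
    then show "principal_curvature_in r (t, x) V (alpha r t)"
      using V unfolding principal_curvature_in_def A ft by (auto simp: prod_eq_iff)
  qed (auto simp: principal_curvature_in_def)
qed

end

theory Submission
  imports Defs
begin

text \<open>The equivalence holds pointwise. Over the common denominator
  \<open>r t * (1 - (deriv r t)\<^sup>2) powr (3 / 2)\<close>, \<open>alpha\<close> has numerator
  \<open>-(1 - (deriv r t)\<^sup>2)\<close>. The same terms occur in the numerator of
  \<open>beta\<close>, so they cancel in \<open>alpha - beta\<close> and leave only
  \<open>-(r t * deriv (deriv r) t)\<close>. Admissibility makes the denominator nonzero, so
  \<open>proportional_iff_ode\<close> can compare numerators.\<close>

lemma alpha_eq:
  assumes "r t > 0" "\<bar>deriv r t\<bar> < 1"
  shows "alpha r t = - (1 - (deriv r t)\<^sup>2) / (r t * (1 - (deriv r t)\<^sup>2) powr (3 / 2))"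
proof -
  define d where "d = 1 - (deriv r t)\<^sup>2"
  have d: "d > 0"
    using assms(2) by (simp add: d_def abs_square_less_1)
  \<comment> \<open>Splitting the exponent as 1 + 1/2 exhibits the factor \<open>d\<close> by which
    the fraction defining \<open>alpha\<close> is expanded.\<close>
  have "d powr (3 / 2) = d * sqrt d"
    using d powr_add[of d 1 "1 / 2"] by (simp add: powr_half_sqrt)
  then show ?thesis
    using d by (simp add: alpha_def d_def[symmetric])
qed

lemma alpha_minus_beta_eq:
  assumes "r t > 0" "\<bar>deriv r t\<bar> < 1"
  shows "alpha r t - beta r t =
    - (r t * deriv (deriv r) t) / (r t * (1 - (deriv r t)\<^sup>2) powr (3 / 2))"
  unfolding alpha_eq[OF assms] beta_def diff_divide_distrib[symmetric]
  by (simp add: algebra_simps)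

lemma proportional_iff_ode:
  assumes "r t > 0" "\<bar>deriv r t\<bar> < 1"
  shows "lam * alpha r t = alpha r t - beta r t \<longleftrightarrow>
    r t * deriv (deriv r) t = lam * (1 - (deriv r t)\<^sup>2)"
proof -
  define c where "c = r t * (1 - (deriv r t)\<^sup>2) powr (3 / 2)"
  have "(deriv r t)\<^sup>2 < 1"
    using assms(2) by (simp add: abs_square_less_1)
  then have c: "c \<noteq> 0"
    using assms(1) by (simp add: c_def)
  have "lam * alpha r t = - (lam * (1 - (deriv r t)\<^sup>2)) / c"
    unfolding alpha_eq[OF assms] c_def by (simp only: times_divide_eq_right mult_minus_right)
  moreover have "alpha r t - beta r t = - (r t * deriv (deriv r) t) / c"
    unfolding alpha_minus_beta_eq[OF assms] c_def ..
  ultimately show ?thesis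
    \<comment> \<open>Both sides are now negated numerators over the same nonzero
      \<open>c\<close>.\<close>
    using c by (metis divide_cancel_right neg_equal_iff_equal)
qed

theorem proposition3p7:
  fixes J :: "real set" and r :: "real \<Rightarrow> real" and lam :: real
  assumes "open J" and "is_interval J" and "0 \<in> J"
    and "admissible J r"
  shows "proportional_principal_curvatures TYPE('n::finite) J r lam \<longleftrightarrow>
    (\<forall>t\<in>J. r t * deriv (deriv r) t = lam * (1 - (deriv r t)\<^sup>2))"
proof -
  have "r t > 0" "\<bar>deriv r t\<bar> < 1" if "t \<in> J" for t
    using assms(4) that by (auto simp: admissible_def)
  then show ?thesis
    \<comment> \<open>The geometric conjunct holds for every admissible \<open>r\<close>, which
      leaves only the pointwise identity on \<open>J\<close>.\<close>
    unfolding proportional_principal_curvatures_def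
    using principal_curvatures_alpha_beta[OF assms(4)] proportional_iff_ode by blast
qed

end
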